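(* Let $f(s,t)$ and $g(s,t)$ be two bivariate real-valued functions defined for $t \ge s \ge 0$, with $f(t,t)=0$ and $g(t,t)=0$ for all $t \ge 0$. Define $h(s,t) = f\otimes g(s,t) = \inf_{\tau\in[s,t]}\{f(s,\tau)+g(\tau,t)\}$ for $t\ge s\ge 0$. Then: (i) If $f$ and $g$ are super-additive, then $h$ is super-additive. (ii) If $f$ and $g$ are additive and univariate, then $h$ is additive.
   Context: A bivariate function $f(s,t)$, $t\ge s\ge 0$, is called super-additive if $f(s,u)\ge f(s,t)+f(t,u)$ for all $u\ge t\ge s\ge 0$, and additive if $f(s,u)=f(s,t)+f(t,u)$ for all $u\ge t\ge s\ge 0$. It is called univariate if it depends only on the difference of its arguments, i.e., $f(s,t)=f(t-s)$. The operator $\otimes$ is min-plus convolution. Infima are taken in the extended reals, so $h$ takes values in $[-\infty,\infty)$, with the usual arithmetic there. *)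

theory Defs
  imports Complex_Main "HOL-Library.Extended_Real"
begin

text \<open>
  A bivariate function \<open>f(s,t)\<close> defined for \<open>0 \<le> s \<le> t\<close> is represented by a total function on
  \<open>real \<times> real\<close> (curried); its values off that domain are arbitrary and are never used.
  The first two predicates are polymorphic in the codomain because they are applied both to
  real-valued functions and to extended-real-valued convolutions.
\<close>

definition biv_super_additive :: "(real \<Rightarrow> real \<Rightarrow> 'a::ordered_ab_semigroup_add) \<Rightarrow> bool" where
  "biv_super_additive f \<longleftrightarrow>
     (\<forall>s t u. 0 \<le> s \<and> s \<le> t \<and> t \<le> u \<longrightarrow> f s u \<ge> f s t + f t u)"

definition biv_additive :: "(real \<Rightarrow> real \<Rightarrow> 'a::ordered_ab_semigroup_add) \<Rightarrow> bool" where
  "biv_additive f \<longleftrightarrow>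
     (\<forall>s t u. 0 \<le> s \<and> s \<le> t \<and> t \<le> u \<longrightarrow> f s u = f s t + f t u)"

definition univariate :: "(real \<Rightarrow> real \<Rightarrow> 'a) \<Rightarrow> bool" where
  "univariate f \<longleftrightarrow> (\<exists>F. \<forall>s t. 0 \<le> s \<and> s \<le> t \<longrightarrow> f s t = F (t - s))"

text \<open>
  The infimum is taken in the extended reals, so it may be \<open>-\<infinity>\<close>. For \<open>s \<le> t\<close> the index set is
  nonempty, so the value is never \<open>\<infinity>\<close> and the convention \<open>\<infinity> + (-\<infinity>) = \<infinity>\<close> of \<^typ>\<open>ereal\<close> plays
  no role in sums of such values.
\<close>

definition min_plus_conv ::
    "(real \<Rightarrow> real \<Rightarrow> real) \<Rightarrow> (real \<Rightarrow> real \<Rightarrow> real) \<Rightarrow> real \<Rightarrow> real \<Rightarrow> ereal"  (infixl "\<otimes>" 70) where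
  "(f \<otimes> g) s t = (INF \<tau>\<in>{s..t}. ereal (f s \<tau> + g \<tau> t))"

end

theory Submission
  imports Defs
begin

text \<open>
  For super-additivity, split the index \<open>\<tau> \<in> [s,u]\<close> of the convolution at \<open>t\<close> and bound one of
  the two convolutions on the left by its value at the end point \<open>t\<close>, where \<open>f\<close> or \<open>g\<close> vanishes.
  For the converse inequality in the additive univariate case, indices \<open>\<tau> \<in> [s,t]\<close> and
  \<open>\<sigma> \<in> [t,u]\<close> combine to the index \<open>\<rho> = \<tau> + \<sigma> - t \<in> [s,u]\<close>, whose value is exactly the sum of the
  two values, because the increments of \<open>f\<close> over \<open>[t,\<sigma>]\<close> and \<open>[\<tau>,\<rho>]\<close> agree, as do those of \<open>g\<close>
  over \<open>[\<tau>,t]\<close> and \<open>[\<rho>,\<sigma>]\<close>. Thus no regularity of \<open>f\<close> and \<open>g\<close> is needed.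
\<close>

lemma min_plus_conv_le:
  assumes "s \<le> \<tau>" "\<tau> \<le> t"
  shows "(f \<otimes> g) s t \<le> ereal (f s \<tau> + g \<tau> t)"
  unfolding min_plus_conv_def using assms by (intro INF_lower) auto

text \<open>Each \<open>X x\<close> is finite, so it can be moved across to \<open>c\<close> before
  the infimum over \<open>B\<close> is taken. If that infimum is finite too, it is moved across in
  the same way and the infimum over \<open>A\<close> is taken.\<close>

lemma le_INF_add_INF_ereal:
  fixes X :: "'a \<Rightarrow> real" and Y :: "'b \<Rightarrow> real"
  assumes "A \<noteq> {}" "B \<noteq> {}"
    and le: "\<And>x y. x \<in> A \<Longrightarrow> y \<in> B \<Longrightarrow> c \<le> ereal (X x + Y y)"
  shows "c \<le> (INF x\<in>A. ereal (X x)) + (INF y\<in>B. ereal (Y y))"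
proof -
  have shift: "c - ereal (X x) \<le> (INF y\<in>B. ereal (Y y))" if "x \<in> A" for x
    using le[OF that] by (intro INF_greatest) (simp add: ereal_minus_le add.commute)
  show ?thesis
  proof (cases "INF y\<in>B. ereal (Y y)")
    case (real r)
    have "c - ereal r \<le> (INF x\<in>A. ereal (X x))"
      using shift real by (intro INF_greatest) (simp add: ereal_minus_le add.commute)
    then show ?thesis
      using real by (simp add: ereal_minus_le)
  next
    case PInf
    then show ?thesis by simp
  next
    \<comment> \<open>Some \<open>x\<close> in \<open>A\<close> exists, and \<open>c - X x\<close>
      is at most \<open>-\<infinity>\<close> with \<open>X x\<close> real, which forces
      \<open>c\<close>.\<close>
    case MInf
    with shift \<open>A \<noteq> {}\<close> have "c = - \<infinity>"
      by (cases c) auto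
    then show ?thesis by simp
  qed
qed

lemma super_additive_min_plus_conv:
  assumes f0: "\<And>t. t \<ge> 0 \<Longrightarrow> f t t = 0" and g0: "\<And>t. t \<ge> 0 \<Longrightarrow> g t t = 0"
    and f: "biv_super_additive f" and g: "biv_super_additive g"
  shows "biv_super_additive (f \<otimes> g)"
  unfolding biv_super_additive_def
proof (intro allI impI)
  fix s t u :: real
  assume "0 \<le> s \<and> s \<le> t \<and> t \<le> u"
  then have st: "0 \<le> s" "s \<le> t" "t \<le> u" by auto
  have "(f \<otimes> g) s t + (f \<otimes> g) t u \<le> ereal (f s \<tau> + g \<tau> u)" if \<tau>: "\<tau> \<in> {s..u}" for \<tau>
  proof (cases "\<tau> \<le> t")
    case True
    \<comment> \<open>Index \<open>\<tau>\<close> serves \<open>[s,t]\<close> and index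
      \<open>t\<close> serves \<open>[t,u]\<close>, so two values of \<open>g\<close> on adjacent
      intervals remain to be merged.\<close>
    have "(f \<otimes> g) s t + (f \<otimes> g) t u \<le> ereal (f s \<tau> + g \<tau> t) + ereal (f t t + g t u)"
      using \<tau> st True by (intro add_mono min_plus_conv_le) auto
    also have "\<dots> \<le> ereal (f s \<tau> + g \<tau> u)"
    proof -
      have "g \<tau> t + g t u \<le> g \<tau> u"
        using g \<tau> st True unfolding biv_super_additive_def by auto
      then show ?thesis
        using f0[of t] st by simp
    qed
    finally show ?thesis .
  next
    case False
    have "(f \<otimes> g) s t + (f \<otimes> g) t u \<le> ereal (f s t + g t t) + ereal (f t \<tau> + g \<tau> u)"
      using \<tau> st False by (intro add_mono min_plus_conv_le) auto
    also have "\<dots> \<le> ereal (f s \<tau> + g \<tau> u)"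
    proof -
      have "f s t + f t \<tau> \<le> f s \<tau>"
        using f \<tau> st False unfolding biv_super_additive_def by auto
      then show ?thesis
        using g0[of t] st by simp
    qed
    finally show ?thesis .
  qed
  then show "(f \<otimes> g) s t + (f \<otimes> g) t u \<le> (f \<otimes> g) s u"
    unfolding min_plus_conv_def[of f g s u] by (rule INF_greatest)
qed

lemma biv_additive_imp_super_additive: "biv_additive f \<Longrightarrow> biv_super_additive f"
  unfolding biv_additive_def biv_super_additive_def by auto

lemma univariate_cong:
  assumes "univariate f" "0 \<le> s" "s \<le> t" "0 \<le> s'" "s' \<le> t'" "t - s = t' - s'"
  shows "f s t = f s' t'"
proof -
  obtain F where F: "\<And>s t. 0 \<le> s \<Longrightarrow> s \<le> t \<Longrightarrow> f s t = F (t - s)"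
    using assms(1) unfolding univariate_def by blast
  show ?thesis
    using assms by (simp add: F)
qed

lemma min_plus_conv_subadditive:
  assumes f: "biv_additive f" "univariate f" and g: "biv_additive g" "univariate g"
    and st: "0 \<le> s" "s \<le> t" "t \<le> u"
  shows "(f \<otimes> g) s u \<le> (f \<otimes> g) s t + (f \<otimes> g) t u"
  unfolding min_plus_conv_def[of f g s t] min_plus_conv_def[of f g t u]
proof (rule le_INF_add_INF_ereal)
  fix \<tau> \<sigma>
  assume "\<tau> \<in> {s..t}" "\<sigma> \<in> {t..u}"
  then have ts: "s \<le> \<tau>" "\<tau> \<le> t" "t \<le> \<sigma>" "\<sigma> \<le> u" by auto
  define \<rho> where "\<rho> = \<tau> + \<sigma> - t"
  \<comment> \<open>Here \<open>\<rho> - \<tau> = \<sigma> - t\<close> and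
    \<open>\<sigma> - \<rho> = t - \<tau>\<close>; \<open>\<rho>\<close> may fall on either side of
    \<open>t\<close>.\<close>
  have \<rho>: "\<tau> \<le> \<rho>" "\<rho> \<le> \<sigma>"
    using ts by (auto simp: \<rho>_def)
  have "f t \<sigma> = f \<tau> \<rho>" "g \<tau> t = g \<rho> \<sigma>"
    using st ts \<rho>
    by (auto intro: univariate_cong[OF f(2)] univariate_cong[OF g(2)] simp: \<rho>_def)
  moreover have "f s \<rho> = f s \<tau> + f \<tau> \<rho>" "g \<rho> u = g \<rho> \<sigma> + g \<sigma> u"
    using f g st ts \<rho> unfolding biv_additive_def by auto
  ultimately have "f s \<rho> + g \<rho> u = (f s \<tau> + g \<tau> t) + (f t \<sigma> + g \<sigma> u)"
    by simp
  moreover have "(f \<otimes> g) s u \<le> ereal (f s \<rho> + g \<rho> u)"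
    using ts \<rho> by (intro min_plus_conv_le) auto
  ultimately show "(f \<otimes> g) s u \<le> ereal ((f s \<tau> + g \<tau> t) + (f t \<sigma> + g \<sigma> u))"
    by simp
qed (use st in auto)

theorem lemma1:
  fixes f g :: "real \<Rightarrow> real \<Rightarrow> real"
  assumes "\<And>t. t \<ge> 0 \<Longrightarrow> f t t = 0"
    and "\<And>t. t \<ge> 0 \<Longrightarrow> g t t = 0"
  shows "(biv_super_additive f \<and> biv_super_additive g \<longrightarrow> biv_super_additive (f \<otimes> g)) \<and>
    (biv_additive f \<and> univariate f \<and> biv_additive g \<and> univariate g \<longrightarrow> biv_additive (f \<otimes> g))"
proof (intro conjI impI)
  assume "biv_super_additive f \<and> biv_super_additive g"
  then show "biv_super_additive (f \<otimes> g)"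
    using super_additive_min_plus_conv assms by blast
next
  assume fg: "biv_additive f \<and> univariate f \<and> biv_additive g \<and> univariate g"
  then have "biv_super_additive (f \<otimes> g)"
    using super_additive_min_plus_conv assms biv_additive_imp_super_additive by blast
  \<comment> \<open>Super-additivity is one of the two inequalities;
    \<open>min_plus_conv_subadditive\<close> is the other.\<close>
  then show "biv_additive (f \<otimes> g)"
    using fg min_plus_conv_subadditive
    unfolding biv_super_additive_def biv_additive_def[of "f \<otimes> g"]
    by (blast intro: antisym)
qed

end
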